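(* Let $N \ge 0$ and $n \ge 0$ be integers, and for each $k \in \{0,1,\dots,n\}$ let $X_k$ be a finite set of cardinality $k$. Then the total number of $N$-ary convexities on $X_n$ is expressed as the binomial transform of the numbers of grounded $N$-ary convexities, namely $$|\Gamma^N(X_n)| = \sum_{k=0}^{n} \binom{n}{k}\, |\Gamma_0^N(X_k)|.$$
   Context: Let $X$ be a (possibly empty) finite set. A convexity $\mathbf{G}$ in $X$ (on the carrier $X$) is a family of subsets of $X$ that contains $X$ and is closed under arbitrary intersections of its elements. Its convex hull operator $g:\mathcal{P}(X)\to\mathcal{P}(X)$ is $gA = \bigcap\{B \in \mathbf{G} : A \subset B\}$ for $A \subset X$. Here $\subset$ allows equality and $\mathcal{P}(X)$ is the power set. For an integer $N \ge 0$, the convexity $\mathbf{G}$ is called $N$-ary if for every $A \subset X$: $A \in \mathbf{G}$ if and only if for all $B \subset A$ with $|B| \le N$ one has $gB \subset A$. A convexity $\mathbf{G}$ is called grounded if $\emptyset \in \mathbf{G}$. $\Gamma^N(X)$ denotes the family of all $N$-ary convexities on $X$, and $\Gamma_0^N(X)$ denotes the family of all grounded $N$-ary convexities on $X$. Convexities are counted as families of subsets of the given (labelled) carrier, not up to isomorphism. *)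

theory Defs
  imports Main "HOL.Hull"
begin

text \<open>
  Since the carrier is a member, only intersections of nonempty subfamilies have to be required;
  the empty intersection, taken relative to the carrier, is the carrier itself.
  The convex hull operator of a family \<open>G\<close> is the library's \<open>(\<lambda>C. C \<in> G) hull A\<close>,
  which is by definition the intersection of all members of \<open>G\<close> that include \<open>A\<close>.
\<close>

definition convexity :: "'a set \<Rightarrow> 'a set set \<Rightarrow> bool" where
  "convexity X G \<longleftrightarrow>
     G \<subseteq> Pow X \<and> X \<in> G \<and> (\<forall>F. F \<subseteq> G \<and> F \<noteq> {} \<longrightarrow> \<Inter>F \<in> G)"

definition convex_hull_op :: "'a set set \<Rightarrow> 'a set \<Rightarrow> 'a set" where
  "convex_hull_op G A = (\<lambda>C. C \<in> G) hull A"

definition nary :: "nat \<Rightarrow> 'a set \<Rightarrow> 'a set set \<Rightarrow> bool" where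
  "nary N X G \<longleftrightarrow>
     (\<forall>A\<subseteq>X. A \<in> G \<longleftrightarrow>
        (\<forall>B. B \<subseteq> A \<and> finite B \<and> card B \<le> N \<longrightarrow> convex_hull_op G B \<subseteq> A))"

definition grounded :: "'a set set \<Rightarrow> bool" where
  "grounded G \<longleftrightarrow> {} \<in> G"

definition nary_convexities :: "nat \<Rightarrow> 'a set \<Rightarrow> 'a set set set" where
  "nary_convexities N X = {G. convexity X G \<and> nary N X G}"

definition grounded_nary_convexities :: "nat \<Rightarrow> 'a set \<Rightarrow> 'a set set set" where
  "grounded_nary_convexities N X = {G. convexity X G \<and> nary N X G \<and> grounded G}"

end

theory Submission
  imports Defs
begin

text \<open>
  An \<open>N\<close>-ary convexity \<open>G\<close> on \<open>X\<close> is determined by the hull \<open>C\<close> of the empty set, which is its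
  least member, together with the family of all \<open>A - C\<close> with \<open>A \<in> G\<close>; the latter is an arbitrary
  grounded \<open>N\<close>-ary convexity on \<open>X - C\<close>. Enlarging the generating sets by points of \<open>C\<close> does not
  change their hulls, so the arity is preserved. Counting the pairs by the cardinality of \<open>X - C\<close>
  gives the binomial transform.
\<close>

section \<open>Hulls and closed sets\<close>

lemma convexity_Inter: "convexity X G \<Longrightarrow> F \<subseteq> G \<Longrightarrow> F \<noteq> {} \<Longrightarrow> \<Inter>F \<in> G"
  by (simp add: convexity_def)

lemma convex_hull_op_eq: "convex_hull_op G B = \<Inter>{A \<in> G. B \<subseteq> A}"
  by (simp add: convex_hull_op_def hull_def)

lemma convex_hull_op_subset:
  assumes "convexity X G" "B \<subseteq> X"
  shows "convex_hull_op G B \<subseteq> X"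
  using assms by (auto simp: convex_hull_op_eq convexity_def)

text \<open>This isolates the arity condition for a single set. It does not mention the carrier, so
  the same predicate serves convexities on \<open>X\<close> and on \<open>X - C\<close>.\<close>

definition nary_closed :: "nat \<Rightarrow> 'a set set \<Rightarrow> 'a set \<Rightarrow> bool" where
  "nary_closed N G A \<longleftrightarrow>
     (\<forall>B. B \<subseteq> A \<and> finite B \<and> card B \<le> N \<longrightarrow> convex_hull_op G B \<subseteq> A)"

lemma nary_iff: "nary N X G \<longleftrightarrow> (\<forall>A\<subseteq>X. A \<in> G \<longleftrightarrow> nary_closed N G A)"
  by (simp add: nary_def nary_closed_def)

subsection \<open>Adjoining points to all members\<close>

text \<open>For \<open>H\<close> on \<open>X - C\<close> this is the family of all
  \<open>A \<union> C\<close> with \<open>A \<in> H\<close>. Testing \<open>A - C\<close> for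
  membership spares an existential witness.\<close>

definition adjoin :: "'a set \<Rightarrow> 'a set set \<Rightarrow> 'a set set" where
  "adjoin C H = {A. C \<subseteq> A \<and> A - C \<in> H}"

text \<open>The maps \<open>A \<mapsto> A \<union> C\<close> and \<open>A \<mapsto> A - C\<close>
  are mutually inverse between \<open>H\<close> and \<open>adjoin C H\<close>, and both commute with
  nonempty intersections.\<close>

lemma convexity_adjoin_iff:
  assumes H: "H \<subseteq> Pow (X - C)" and C: "C \<subseteq> X"
  shows "convexity X (adjoin C H) \<longleftrightarrow> convexity (X - C) H"
proof
  assume conv: "convexity X (adjoin C H)"
  have "\<Inter>F \<in> H" if F: "F \<subseteq> H" "F \<noteq> {}" for F
  proof -
    have "(\<lambda>A. A \<union> C) ` F \<subseteq> adjoin C H"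
    proof
      fix A assume "A \<in> (\<lambda>A. A \<union> C) ` F"
      then obtain A' where "A' \<in> F" "A = A' \<union> C" by blast
      moreover from this have "A - C = A'" using F H by blast
      ultimately show "A \<in> adjoin C H" using F by (auto simp: adjoin_def)
    qed
    then have "\<Inter>((\<lambda>A. A \<union> C) ` F) \<in> adjoin C H"
      using convexity_Inter[OF conv] F by blast
    moreover have "\<Inter>((\<lambda>A. A \<union> C) ` F) - C = \<Inter>F" using F H by blast
    ultimately show ?thesis by (simp add: adjoin_def)
  qed
  then show "convexity (X - C) H" using conv H by (auto simp: convexity_def adjoin_def)
next
  assume conv: "convexity (X - C) H"
  have "\<Inter>F \<in> adjoin C H" if F: "F \<subseteq> adjoin C H" "F \<noteq> {}" for F
  proof -
    have "\<Inter>((\<lambda>A. A - C) ` F) \<in> H"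
      using convexity_Inter[OF conv, of "(\<lambda>A. A - C) ` F"] F by (auto simp: adjoin_def)
    moreover have "\<Inter>((\<lambda>A. A - C) ` F) = \<Inter>F - C" using F by blast
    ultimately show ?thesis using F by (auto simp: adjoin_def)
  qed
  moreover have "adjoin C H \<subseteq> Pow X" using H C by (auto simp: adjoin_def)
  ultimately show "convexity X (adjoin C H)"
    using conv C by (simp add: convexity_def adjoin_def)
qed

text \<open>Members above \<open>B\<close> in the adjoined family are exactly the sets
  \<open>C \<union> A\<close> for members \<open>A\<close> of \<open>H\<close> above
  \<open>B - C\<close>.\<close>

lemma convex_hull_op_adjoin:
  assumes "\<Union>H \<inter> C = {}"
  shows "convex_hull_op (adjoin C H) B = C \<union> convex_hull_op H (B - C)"
proof -
  have "{A \<in> adjoin C H. B \<subseteq> A} = (\<lambda>A. C \<union> A) ` {A \<in> H. B - C \<subseteq> A}" (is "?L = ?R")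
  proof
    show "?L \<subseteq> ?R"
    proof
      fix A assume "A \<in> ?L"
      then have "A = C \<union> (A - C)" "A - C \<in> {A \<in> H. B - C \<subseteq> A}"
        by (auto simp: adjoin_def)
      then show "A \<in> ?R" by blast
    qed
    show "?R \<subseteq> ?L"
    proof
      fix A assume "A \<in> ?R"
      then obtain A' where A': "A' \<in> H" "B - C \<subseteq> A'" "A = C \<union> A'" by blast
      moreover from this have "A - C = A'" using assms by blast
      ultimately show "A \<in> ?L" by (auto simp: adjoin_def)
    qed
  qed
  \<comment> \<open>If no member of \<open>H\<close> includes \<open>B - C\<close>, both sides are
    \<open>UNIV\<close>, so this case needs no separate treatment.\<close>
  then show ?thesis by (auto simp: convex_hull_op_eq)
qed

lemma nary_closed_adjoin_iff:
  assumes conv: "convexity (X - C) H" and A: "A \<subseteq> X"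
  shows "nary_closed N (adjoin C H) A \<longleftrightarrow> C \<subseteq> A \<and> nary_closed N H (A - C)"
proof -
  have "\<Union>H \<inter> C = {}" using conv by (auto simp: convexity_def)
  note hull = convex_hull_op_adjoin[OF this]
  show ?thesis
  proof (intro iffI conjI)
    assume cl: "nary_closed N (adjoin C H) A"
    \<comment> \<open>The empty set satisfies the cardinality bound for every \<open>N\<close>, even
      for \<open>N = 0\<close>, and its hull includes \<open>C\<close>.\<close>
    then have "convex_hull_op (adjoin C H) {} \<subseteq> A" by (simp add: nary_closed_def)
    then show "C \<subseteq> A" by (simp add: hull)
    show "nary_closed N H (A - C)"
      unfolding nary_closed_def
    proof (intro allI impI, elim conjE)
      fix B assume B: "B \<subseteq> A - C" "finite B" "card B \<le> N"
      then have "convex_hull_op (adjoin C H) B \<subseteq> A" using cl by (auto simp: nary_closed_def)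
      moreover have "B - C = B" using B by blast
      \<comment> \<open>The hull in \<open>H\<close> avoids \<open>C\<close>, which sharpens
        inclusion in \<open>A\<close> to inclusion in \<open>A - C\<close>.\<close>
      moreover have "convex_hull_op H B \<subseteq> X - C"
        using convex_hull_op_subset[OF conv, of B] B A by blast
      ultimately show "convex_hull_op H B \<subseteq> A - C" by (auto simp: hull)
    qed
  next
    assume "C \<subseteq> A \<and> nary_closed N H (A - C)"
    then have C: "C \<subseteq> A" and cl: "nary_closed N H (A - C)" by auto
    show "nary_closed N (adjoin C H) A"
      unfolding nary_closed_def
    proof (intro allI impI, elim conjE)
      fix B assume B: "B \<subseteq> A" "finite B" "card B \<le> N"
      then have "card (B - C) \<le> N" by (meson Diff_subset card_mono le_trans)
      then have "convex_hull_op H (B - C) \<subseteq> A - C"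
        using cl B by (simp add: nary_closed_def Diff_mono)
      then show "convex_hull_op (adjoin C H) B \<subseteq> A" using C by (auto simp: hull)
    qed
  qed
qed

text \<open>The sets between \<open>C\<close> and \<open>X\<close> correspond to the subsets of
  \<open>X - C\<close>. For a subset \<open>A\<close> of \<open>X\<close> that does not include
  \<open>C\<close>, membership in the adjoined family and closedness both fail, so the equivalence
  holds there as well.\<close>

lemma nary_adjoin_iff:
  assumes conv: "convexity (X - C) H" and C: "C \<subseteq> X"
  shows "nary N X (adjoin C H) \<longleftrightarrow> nary N (X - C) H"
proof
  assume nary: "nary N X (adjoin C H)"
  have "A \<in> H \<longleftrightarrow> nary_closed N H A" if A: "A \<subseteq> X - C" for A
  proof -
    have AC: "A \<union> C \<subseteq> X" "A \<union> C - C = A" using A C by auto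
    then have "A \<in> H \<longleftrightarrow> A \<union> C \<in> adjoin C H" by (simp add: adjoin_def)
    also have "\<dots> \<longleftrightarrow> nary_closed N (adjoin C H) (A \<union> C)"
      using nary AC(1) unfolding nary_iff by blast
    also have "\<dots> \<longleftrightarrow> nary_closed N H A"
      using nary_closed_adjoin_iff[OF conv AC(1), of N] AC(2) by simp
    finally show ?thesis .
  qed
  then show "nary N (X - C) H" by (simp add: nary_iff)
next
  assume nary: "nary N (X - C) H"
  have "A \<in> adjoin C H \<longleftrightarrow> nary_closed N (adjoin C H) A" if A: "A \<subseteq> X" for A
  proof -
    have "A - C \<subseteq> X - C" using A by blast
    then show ?thesis
      using nary nary_closed_adjoin_iff[OF conv A, of N] by (simp add: nary_iff adjoin_def)
  qed
  then show "nary N X (adjoin C H)" by (simp add: nary_iff)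
qed

text \<open>Groundedness puts \<open>C\<close> itself into the family, as its least member. Hence
  \<open>C\<close> can be read off from \<open>adjoin C H\<close>, which gives half of the
  injectivity below.\<close>

lemma Inter_adjoin:
  assumes "{} \<in> H"
  shows "\<Inter>(adjoin C H) = C"
  using assms by (auto simp: adjoin_def)

lemma bij_betw_adjoin:
  "bij_betw (\<lambda>(C, H). adjoin C H)
     (SIGMA C:Pow X. grounded_nary_convexities N (X - C)) (nary_convexities N X)"
  (is "bij_betw ?f ?S ?T")
proof (intro bij_betw_imageI subset_antisym)
  have groundedD: "{} \<in> H" "H \<subseteq> Pow (X - C)"
    if "H \<in> grounded_nary_convexities N (X - C)" for C H
    using that by (auto simp: grounded_nary_convexities_def grounded_def convexity_def)
  have subset: "H \<subseteq> H'"
    if "H \<subseteq> Pow (X - C)" and eq: "adjoin C H = adjoin C H'" for C H H'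
  proof
    fix A assume "A \<in> H"
    moreover from this have A: "A \<union> C - C = A" using that by blast
    ultimately have "A \<union> C \<in> adjoin C H" by (simp add: adjoin_def)
    then show "A \<in> H'" unfolding eq by (simp add: adjoin_def A)
  qed
  show "inj_on ?f ?S"
  proof (rule inj_onI, clarify)
    fix C H C' H'
    assume H: "H \<in> grounded_nary_convexities N (X - C)"
      and H': "H' \<in> grounded_nary_convexities N (X - C')"
      and eq: "adjoin C H = adjoin C' H'"
    have "C = C'"
      using Inter_adjoin[OF groundedD(1)[OF H], of C] Inter_adjoin[OF groundedD(1)[OF H'], of C'] eq
      by simp
    moreover from this have "H = H'"
      using subset groundedD(2) H H' eq by (metis subset_antisym)
    ultimately show "C = C' \<and> H = H'" by simp
  qed
  show "?f ` ?S \<subseteq> ?T"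
  proof clarify
    fix C H assume C: "C \<subseteq> X" and H: "H \<in> grounded_nary_convexities N (X - C)"
    then show "adjoin C H \<in> ?T"
      using convexity_adjoin_iff[OF groundedD(2)[OF H] C] nary_adjoin_iff[OF _ C, of H N]
      by (simp add: nary_convexities_def grounded_nary_convexities_def)
  qed
  show "?T \<subseteq> ?f ` ?S"
  proof
    fix G assume "G \<in> ?T"
    then have conv: "convexity X G" and nary: "nary N X G" by (auto simp: nary_convexities_def)
    \<comment> \<open>The preimage of \<open>G\<close>: since \<open>X \<in> G\<close>, the
      intersection is over a nonempty family and lies in \<open>G\<close>. This is also what makes
      \<open>H\<close> grounded.\<close>
    define C where "C = \<Inter>G"
    define H where "H = {A \<in> Pow (X - C). A \<union> C \<in> G}"
    have CG: "C \<in> G"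
      unfolding C_def using conv by (auto intro: convexity_Inter simp: convexity_def)
    have GX: "G \<subseteq> Pow X" using conv by (simp add: convexity_def)
    have C: "C \<subseteq> X" using CG GX by auto
    have le: "C \<subseteq> A" if "A \<in> G" for A using that by (auto simp: C_def)
    have G: "G = adjoin C H"
    proof (intro set_eqI iffI)
      fix A assume A: "A \<in> G"
      then have "A - C \<union> C = A" using le by blast
      then show "A \<in> adjoin C H" using A le GX by (auto simp: adjoin_def H_def)
    next
      fix A assume A: "A \<in> adjoin C H"
      then have "A - C \<union> C = A" by (auto simp: adjoin_def)
      then show "A \<in> G" using A by (simp add: adjoin_def H_def)
    qed
    have H: "H \<subseteq> Pow (X - C)" by (auto simp: H_def)
    have convH: "convexity (X - C) H" using convexity_adjoin_iff[OF H C] conv G by simp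
    have "nary N (X - C) H" using nary_adjoin_iff[OF convH C] nary G by simp
    moreover have "{} \<in> H" using CG by (simp add: H_def)
    ultimately have "H \<in> grounded_nary_convexities N (X - C)"
      using convH by (simp add: grounded_nary_convexities_def grounded_def)
    then show "G \<in> ?f ` ?S" using C G by (intro image_eqI[of _ _ "(C, H)"]) auto
  qed
qed

subsection \<open>Transport along bijections\<close>

text \<open>Injectivity lets images commute with intersections of subsets of \<open>X\<close>;
  nonemptiness excludes the default value \<open>UNIV\<close>.\<close>

lemma Inter_image_inj_on:
  assumes "inj_on f X" "F \<subseteq> Pow X" "F \<noteq> {}"
  shows "\<Inter>((`) f ` F) = f ` \<Inter>F"
proof -
  obtain A where "A \<in> F" using assms by blast
  then show ?thesis
    using image_INT[of f X F "\<lambda>A. A" A] assms by auto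
qed

text \<open>Inclusion, nonempty intersection and cardinality are preserved by images under an
  injective map, and inclusion is also reflected. All the notions involved are built from
  these.\<close>

lemma image_grounded_nary_convexities:
  assumes inj: "inj_on f X" and G: "G \<in> grounded_nary_convexities N X"
  shows "(`) f ` G \<in> grounded_nary_convexities N (f ` X)"
proof -
  have conv: "convexity X G" and nary: "nary N X G" and "grounded G"
    using G by (auto simp: grounded_nary_convexities_def)
  have GX: "G \<subseteq> Pow X" and XG: "X \<in> G" using conv by (auto simp: convexity_def)
  have sub_iff: "f ` A \<subseteq> f ` B \<longleftrightarrow> A \<subseteq> B" if "A \<subseteq> X" "B \<subseteq> X" for A B
    using inj_on_image_eq_iff[OF inj, of "A \<union> B" B] that
    by (metis Un_least image_Un subset_Un_eq)
  have mem_iff: "f ` A \<in> (`) f ` G \<longleftrightarrow> A \<in> G" if "A \<subseteq> X" for A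
  proof
    assume "f ` A \<in> (`) f ` G"
    then obtain A' where "A' \<in> G" "f ` A = f ` A'" by (rule imageE)
    moreover from this have "A = A'" using that GX inj_on_image_eq_iff[OF inj, of A A'] by auto
    ultimately show "A \<in> G" by simp
  qed (rule imageI)
  have "\<Inter>F \<in> (`) f ` G" if F: "F \<subseteq> (`) f ` G" "F \<noteq> {}" for F
  proof -
    obtain F' where F': "F' \<subseteq> G" "F = (`) f ` F'" using F(1) by (rule subset_imageE)
    then have "F' \<subseteq> Pow X" "F' \<noteq> {}" using F(2) GX by auto
    then have "\<Inter>F = f ` \<Inter>F'" "\<Inter>F' \<in> G"
      using Inter_image_inj_on[OF inj] convexity_Inter[OF conv F'(1)] F'(2) by auto
    then show ?thesis by simp
  qed
  moreover have "(`) f ` G \<subseteq> Pow (f ` X)" using GX by blast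
  ultimately have conv': "convexity (f ` X) ((`) f ` G)"
    using XG by (simp add: convexity_def)
  have hull: "convex_hull_op ((`) f ` G) (f ` B) = f ` convex_hull_op G B" if B: "B \<subseteq> X" for B
  proof -
    have "{A \<in> (`) f ` G. f ` B \<subseteq> A} = (`) f ` {A \<in> G. B \<subseteq> A}"
      using sub_iff[OF B] GX by auto
    \<comment> \<open>The carrier \<open>X\<close> is a member above \<open>B\<close>, so the
      intersection that defines the hull is nonempty and commutes with the image.\<close>
    moreover have "{A \<in> G. B \<subseteq> A} \<subseteq> Pow X" "{A \<in> G. B \<subseteq> A} \<noteq> {}" using GX XG B by auto
    ultimately show ?thesis
      unfolding convex_hull_op_eq by (metis Inter_image_inj_on[OF inj])
  qed
  have card: "finite (f ` B) \<longleftrightarrow> finite B" "card (f ` B) = card B" if "B \<subseteq> X" for B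
    using that inj inj_on_subset[OF inj that] by (auto simp: finite_image_iff card_image)
  have closed: "nary_closed N ((`) f ` G) (f ` A) \<longleftrightarrow> nary_closed N G A" if A: "A \<subseteq> X" for A
  proof -
    have hull_iff: "convex_hull_op ((`) f ` G) (f ` B) \<subseteq> f ` A \<longleftrightarrow> convex_hull_op G B \<subseteq> A"
      if "B \<subseteq> A" for B
    proof -
      have B: "B \<subseteq> X" using that A by blast
      show ?thesis
        unfolding hull[OF B] by (rule sub_iff[OF convex_hull_op_subset[OF conv B] A])
    qed
    show ?thesis
    proof
      assume cl: "nary_closed N ((`) f ` G) (f ` A)"
      show "nary_closed N G A"
        unfolding nary_closed_def
      proof (intro allI impI, elim conjE)
        fix B assume B: "B \<subseteq> A" "finite B" "card B \<le> N"
        then have "f ` B \<subseteq> f ` A" "finite (f ` B)" "card (f ` B) \<le> N"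
          using card[of B] A by auto
        then have "convex_hull_op ((`) f ` G) (f ` B) \<subseteq> f ` A"
          using cl unfolding nary_closed_def by blast
        then show "convex_hull_op G B \<subseteq> A" using hull_iff[OF B(1)] by simp
      qed
    next
      assume cl: "nary_closed N G A"
      show "nary_closed N ((`) f ` G) (f ` A)"
        unfolding nary_closed_def
      proof (intro allI impI, elim conjE)
        fix B' assume B': "B' \<subseteq> f ` A" "finite B'" "card B' \<le> N"
        then obtain B where B: "B \<subseteq> A" "B' = f ` B" by (blast elim: subset_imageE)
        then have "convex_hull_op G B \<subseteq> A"
          using cl B' card[of B] A unfolding nary_closed_def by auto
        then show "convex_hull_op ((`) f ` G) B' \<subseteq> f ` A" using hull_iff[OF B(1)] B(2) by simp
      qed
    qed
  qed
  have "nary N (f ` X) ((`) f ` G)"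
    unfolding nary_iff
  proof (intro allI impI)
    fix A' assume "A' \<subseteq> f ` X"
    then obtain A where "A \<subseteq> X" "A' = f ` A" by (blast elim: subset_imageE)
    then show "A' \<in> (`) f ` G \<longleftrightarrow> nary_closed N ((`) f ` G) A'"
      using mem_iff closed nary by (simp add: nary_iff)
  qed
  moreover have "grounded ((`) f ` G)" using \<open>grounded G\<close> by (auto simp: grounded_def)
  ultimately show ?thesis using conv' by (simp add: grounded_nary_convexities_def)
qed

section \<open>Counting\<close>

lemma finite_grounded_nary_convexities:
  assumes "finite X"
  shows "finite (grounded_nary_convexities N X)"
  by (rule finite_subset[of _ "Pow (Pow X)"])
    (use assms in \<open>auto simp: grounded_nary_convexities_def convexity_def\<close>)

text \<open>A bijection of the carriers, lifted twice to images, maps one finite family injectively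
  into the other. Exchanging the carriers then yields equality.\<close>

lemma card_grounded_nary_convexities_le:
  assumes "finite X" "finite Y" "card X = card Y"
  shows "card (grounded_nary_convexities N X) \<le> card (grounded_nary_convexities N Y)"
proof -
  obtain f where f: "bij_betw f X Y" using assms finite_same_card_bij by blast
  then have inj: "inj_on f X" and Y: "f ` X = Y" by (auto simp: bij_betw_def)
  have "inj_on ((`) ((`) f)) (grounded_nary_convexities N X)"
  proof (rule inj_on_subset)
    show "inj_on ((`) ((`) f)) (Pow (Pow X))"
      by (intro inj_on_image_Pow inj)
    show "grounded_nary_convexities N X \<subseteq> Pow (Pow X)"
      by (auto simp: grounded_nary_convexities_def convexity_def)
  qed
  then show ?thesis
    by (rule card_inj_on_le)
      (use image_grounded_nary_convexities[OF inj] Y finite_grounded_nary_convexities assms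
        in auto)
qed

lemma card_grounded_nary_convexities_cong:
  assumes "finite X" "finite Y" "card X = card Y"
  shows "card (grounded_nary_convexities N X) = card (grounded_nary_convexities N Y)"
  using assms by (simp add: antisym card_grounded_nary_convexities_le)

text \<open>The subsets are grouped by cardinality, and the group of size \<open>k\<close>
  contributes its binomial count times a constant summand.\<close>

lemma sum_Pow_card:
  fixes g :: "nat \<Rightarrow> 'b::comm_semiring_1"
  assumes "finite X"
  shows "(\<Sum>C\<in>Pow X. g (card C)) = (\<Sum>k=0..card X. of_nat (card X choose k) * g k)"
proof -
  have "(\<Sum>C\<in>Pow X. g (card C)) = (\<Sum>k=0..card X. \<Sum>C\<in>{C \<in> Pow X. card C = k}. g (card C))"
    using assms by (intro sum.group[symmetric]) (auto simp: card_mono)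
  also have "\<dots> = (\<Sum>k=0..card X. of_nat (card X choose k) * g k)"
    using assms by (intro sum.cong) (auto simp: n_subsets)
  finally show ?thesis .
qed

theorem mainTheorem1:
  fixes N n :: nat and X :: "nat \<Rightarrow> 'a set"
  assumes "\<And>k. k \<le> n \<Longrightarrow> finite (X k)"
    and "\<And>k. k \<le> n \<Longrightarrow> card (X k) = k"
  shows "card (nary_convexities N (X n)) =
    (\<Sum>k=0..n. (n choose k) * card (grounded_nary_convexities N (X k)))"
proof -
  have fin: "finite (X n)" and card: "card (X n) = n" using assms by auto
  have "card (nary_convexities N (X n)) =
      card (SIGMA C:Pow (X n). grounded_nary_convexities N (X n - C))"
    using bij_betw_same_card[OF bij_betw_adjoin] by metis
  also have "\<dots> = (\<Sum>C\<in>Pow (X n). card (grounded_nary_convexities N (X n - C)))"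
    using fin by (simp add: finite_grounded_nary_convexities)
  \<comment> \<open>Complementation is an involution of the power set; afterwards \<open>C\<close>
    is the carrier of the grounded convexity instead of the least member.\<close>
  also have "\<dots> = (\<Sum>C\<in>Pow (X n). card (grounded_nary_convexities N C))"
    by (rule sum.reindex_bij_witness[of _ "\<lambda>C. X n - C" "\<lambda>C. X n - C"])
      (auto simp: double_diff)
  \<comment> \<open>The sets \<open>X k\<close> may be unrelated to the subsets of
    \<open>X n\<close>, so \<open>C\<close> is replaced by the given set of the same
    cardinality.\<close>
  also have "\<dots> = (\<Sum>C\<in>Pow (X n). card (grounded_nary_convexities N (X (card C))))"
  proof (rule sum.cong[OF refl])
    fix C assume "C \<in> Pow (X n)"
    then have "finite C" "card C \<le> n"
      using fin card by (auto intro: finite_subset dest: card_mono[OF fin])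
    then show "card (grounded_nary_convexities N C) =
        card (grounded_nary_convexities N (X (card C)))"
      using assms by (intro card_grounded_nary_convexities_cong) auto
  qed
  also have "\<dots> = (\<Sum>k=0..n. (n choose k) * card (grounded_nary_convexities N (X k)))"
    using sum_Pow_card[OF fin, of "\<lambda>k. card (grounded_nary_convexities N (X k))"] card by simp
  finally show ?thesis .
qed

end
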